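(* Let $n\ge 4$ and let $G$ be the complete convex geometric graph on $P=\{0,1,\ldots,n-1\}$, the vertex set of a convex $n$-gon $C$. Let $B$ be any blocker (for triangulations of $C$). Then, up to a cyclic rotation of $P$ (i.e. after applying to all vertices a shift $v\mapsto v+r \pmod n$ for some $r$), $B=B_1\cup B_2$ with $$B_1=\{(0,2),(1,3),(2,4),\dots,(m,m+2)\},$$ $$B_2=\{(m+3,i_1),(m+4,i_2),(m+5,i_3),\dots,(n-1,i_{n-3-m})\},$$ for some integer $1\le m\le n-3$ and some integers $i_1,\ldots,i_{n-3-m}$ with $1\le i_j\le m+1$ for all $j$, such that for all $j,k$, if $|i_j-i_k|\ge 2$ then the diagonals $(m+j+2,i_j)$ and $(m+k+2,i_k)$ do not cross. (When $m=n-3$, $B_2=\emptyset$.)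
   Context: $P$ is a set of $n$ points in convex position in the plane forming a convex $n$-gon $C$, labelled cyclically clockwise $0,1,\ldots,n-1$ (indices are taken modulo $n$). $G$ is the complete geometric graph on $P$ (edges are straight segments). The order of an edge $(i,j)$ is $\min\{|i-j|,n-|i-j|\}$; a diagonal of $C$ is an edge of order at least $2$. Two distinct edges cross if they share an interior point. A triangulation of $C$ is a subgraph $T$ of $G$ whose edge set $E(T)$ is a maximal (with respect to inclusion) set of pairwise non-crossing diagonals of $C$. A blocking set is a set of edges of $G$ that has at least one edge in common with every triangulation of $C$. A blocker is a blocking set with the minimum possible number of edges. *)

theory Defs
  imports "HOL-Analysis.Analysis"
begin

text \<open>The point labelled \<open>i\<close> is \<open>p i\<close>, for \<open>i < n\<close>; values of \<open>p\<close> at other arguments play no role.\<close>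

definition convex_position :: "(real ^ 2) set \<Rightarrow> bool" where
  "convex_position S \<longleftrightarrow> (\<forall>x\<in>S. x \<notin> convex hull (S - {x}))"

text \<open>Twice the signed area of the triangle \<open>a b c\<close>; it is negative iff \<open>c\<close> lies strictly to the
  right of the directed line from \<open>a\<close> to \<open>b\<close>.\<close>

definition orient :: "real ^ 2 \<Rightarrow> real ^ 2 \<Rightarrow> real ^ 2 \<Rightarrow> real" where
  "orient a b c = (b $ 1 - a $ 1) * (c $ 2 - a $ 2) - (b $ 2 - a $ 2) * (c $ 1 - a $ 1)"

text \<open>The last conjunct says that consecutive points span the sides of the polygon and that the
  labels run clockwise: the rest of the polygon is to the right of each side
  from \<open>p i\<close> to \<open>p (i + 1)\<close>.\<close>

definition convex_ngon :: "nat \<Rightarrow> (nat \<Rightarrow> real ^ 2) \<Rightarrow> bool" where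
  "convex_ngon n p \<longleftrightarrow>
     inj_on p {..<n} \<and> convex_position (p ` {..<n}) \<and>
     (\<forall>i<n. \<forall>k<n. k \<noteq> i \<longrightarrow> k \<noteq> (i + 1) mod n \<longrightarrow>
        orient (p i) (p ((i + 1) mod n)) (p k) < 0)"

text \<open>An edge of the complete geometric graph is given by the set of the labels of its endpoints.\<close>

definition edges :: "nat \<Rightarrow> nat set set" where
  "edges n = {{i, j} | i j. i < n \<and> j < n \<and> i \<noteq> j}"

definition edge_order :: "nat \<Rightarrow> nat \<Rightarrow> nat \<Rightarrow> int" where
  "edge_order n i j = min \<bar>int i - int j\<bar> (int n - \<bar>int i - int j\<bar>)"

definition diagonals :: "nat \<Rightarrow> nat set set" where
  "diagonals n = {{i, j} | i j. i < n \<and> j < n \<and> i \<noteq> j \<and> edge_order n i j \<ge> 2}"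

definition crosses :: "(nat \<Rightarrow> real ^ 2) \<Rightarrow> nat set \<Rightarrow> nat set \<Rightarrow> bool" where
  "crosses p e f \<longleftrightarrow>
     e \<noteq> f \<and>
     (\<exists>a b c d. e = {a, b} \<and> f = {c, d} \<and>
        open_segment (p a) (p b) \<inter> open_segment (p c) (p d) \<noteq> {})"

definition noncrossing_diagonals :: "nat \<Rightarrow> (nat \<Rightarrow> real ^ 2) \<Rightarrow> nat set set \<Rightarrow> bool" where
  "noncrossing_diagonals n p T \<longleftrightarrow>
     T \<subseteq> diagonals n \<and> (\<forall>e\<in>T. \<forall>f\<in>T. \<not> crosses p e f)"

text \<open>A triangulation is identified with its edge set.\<close>

definition triangulation :: "nat \<Rightarrow> (nat \<Rightarrow> real ^ 2) \<Rightarrow> nat set set \<Rightarrow> bool" where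
  "triangulation n p T \<longleftrightarrow>
     noncrossing_diagonals n p T \<and>
     (\<forall>T'. noncrossing_diagonals n p T' \<longrightarrow> T \<subseteq> T' \<longrightarrow> T' = T)"

definition blocking_set :: "nat \<Rightarrow> (nat \<Rightarrow> real ^ 2) \<Rightarrow> nat set set \<Rightarrow> bool" where
  "blocking_set n p B \<longleftrightarrow>
     B \<subseteq> edges n \<and> (\<forall>T. triangulation n p T \<longrightarrow> B \<inter> T \<noteq> {})"

definition blocker :: "nat \<Rightarrow> (nat \<Rightarrow> real ^ 2) \<Rightarrow> nat set set \<Rightarrow> bool" where
  "blocker n p B \<longleftrightarrow>
     blocking_set n p B \<and> (\<forall>B'. blocking_set n p B' \<longrightarrow> card B \<le> card B')"

definition rotate_edges :: "nat \<Rightarrow> nat \<Rightarrow> nat set set \<Rightarrow> nat set set" where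
  "rotate_edges n r B = (\<lambda>e. (\<lambda>v. (v + r) mod n) ` e) ` B"

end

theory Submission
  imports Defs "HOL-Number_Theory.Cong"
begin

text \<open>
  If the diagonal \<open>(v - 1, v + 1)\<close> cutting off \<open>v\<close> is not in a blocker \<open>B\<close>, then the edges of \<open>B\<close>
  avoiding \<open>v\<close> block the polygon without \<open>v\<close>, whereas by the fan at \<open>v\<close> some edge of \<open>B\<close> contains
  \<open>v\<close>. Induction gives \<open>|B| \<ge> n - 2\<close>, and since the diagonals \<open>(l, l + 2)\<close>, \<open>l \<le> n - 3\<close>, form a
  blocking set, \<open>|B| = n - 2\<close> and every such \<open>v\<close> has exactly one edge \<open>(v, t)\<close> in \<open>B\<close>.
  The fan at \<open>v\<close> with \<open>(v, t)\<close> flipped shows that \<open>(t - 1, t + 1) \<in> B\<close>.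
  For two such vertices \<open>u, v\<close>, cutting along \<open>(u, v)\<close> and using a fan at \<open>u\<close> on one side and at
  \<open>v\<close> on the other shows that their two edges lie on the same side of \<open>(u, v)\<close>. Hence the vertices
  cut off by diagonals in \<open>B\<close> form an interval, and all remaining edges join the other vertices to it.
  If two of these edges \<open>(u, a)\<close>, \<open>(v, b)\<close> crossed and \<open>c\<close> lay strictly between \<open>a\<close> and \<open>b\<close>, then
  the triangle \<open>u v c\<close> with fans at \<open>u\<close>, \<open>u\<close> and \<open>v\<close> would avoid \<open>B\<close>.
\<close>

section \<open>Cutting off ears\<close>

text \<open>
  The polygon with the vertices \<open>xs\<close> in cyclic order has a triangulation avoiding \<open>B\<close>, expressed
  without geometry: it can be reduced to at most three vertices by cutting off ears along
  diagonals outside \<open>B\<close>.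
\<close>

inductive ear_good :: "'a set set \<Rightarrow> 'a list \<Rightarrow> bool" for B where
  small: "length xs \<le> 3 \<Longrightarrow> ear_good B xs"
| ear: "{a, b} \<notin> B \<Longrightarrow> xs \<noteq> [] \<Longrightarrow> ear_good B (a # b # xs) \<Longrightarrow> ear_good B (a # v # b # xs)"
| rot: "ear_good B (xs @ [x]) \<Longrightarrow> ear_good B (x # xs)"

lemma ear_good_append_commute: "ear_good B (ys @ xs) \<Longrightarrow> ear_good B (xs @ ys)"
proof (induction xs arbitrary: ys)
  case (Cons x xs)
  then have "ear_good B (xs @ (ys @ [x]))"
    using Cons.IH[of "ys @ [x]"] by simp
  then show ?case
    using ear_good.rot[of B "xs @ ys" x] by simp
qed simp

text \<open>The rule \<open>ear\<close> with the tip in front: read cyclically, the neighbours of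
  \<open>v\<close> are \<open>last ys\<close> and \<open>hd ys\<close>.\<close>

lemma ear_good_cut:
  assumes "ear_good B ys" "{last ys, hd ys} \<notin> B"
  shows "ear_good B (v # ys)"
proof (cases "length ys \<le> 2")
  case True
  then show ?thesis by (intro ear_good.small) simp
next
  case False
  then obtain b zs where ys: "ys = b # zs" by (cases ys) auto
  with False have "zs \<noteq> []" by auto
  then obtain xs a where zs: "zs = xs @ [a]" by (cases zs rule: rev_cases) auto
  have "xs \<noteq> []" using False ys zs by auto
  moreover have "ear_good B (a # b # xs)"
    using assms(1) ear_good_append_commute[of B "b # xs" "[a]"] ys zs by simp
  moreover have "{a, b} \<notin> B" using assms(2) ys zs by simp
  ultimately have "ear_good B (a # v # b # xs)" by (intro ear_good.ear)
  then show ?thesis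
    using ear_good_append_commute[of B "[a]" "v # b # xs"] ys zs by simp
qed

text \<open>Beyond the chord from \<open>u\<close> to \<open>w\<close>, the vertices
  \<open>ys\<close> are put back as ears of a fan at \<open>u\<close>, beginning next to
  \<open>w\<close>.\<close>

lemma ear_good_fan_left:
  assumes "ear_good B (u # w # zs)" "\<forall>y\<in>set ys. {u, y} \<notin> B" "{u, w} \<notin> B"
  shows "ear_good B (u # ys @ w # zs)"
  using assms
proof (induction ys)
  case (Cons y ys)
  have IH: "ear_good B (u # ys @ w # zs)" using Cons by auto
  have "{u, hd (ys @ w # zs)} \<notin> B" using Cons.prems by (cases ys) auto
  then have "ear_good B (y # (ys @ w # zs) @ [u])"
    using ear_good_append_commute[of B "[u]" "ys @ w # zs"] IH
    by (intro ear_good_cut) (auto simp: hd_append)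
  then show ?case
    using ear_good_append_commute[of B "y # ys @ w # zs" "[u]"] by simp
qed simp

lemma ear_good_fan_right:
  assumes "ear_good B (u # w # zs)" "\<forall>y\<in>set ys. {w, y} \<notin> B" "{u, w} \<notin> B"
  shows "ear_good B (u # ys @ w # zs)"
  using assms
proof (induction ys rule: rev_induct)
  case (snoc y ys)
  have IH: "ear_good B (u # ys @ w # zs)" using snoc by auto
  have "{last (u # ys), w} \<notin> B"
    using snoc.prems by (cases ys rule: rev_cases) (auto simp: insert_commute)
  then have "ear_good B (y # (w # zs) @ u # ys)"
    using ear_good_append_commute[of B "u # ys" "w # zs"] IH
    by (intro ear_good_cut) (auto split: if_splits)
  then show ?case
    using ear_good_append_commute[of B "y # w # zs" "u # ys"] by simp
qed simp

lemma ear_good_fan: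
  assumes "\<forall>y\<in>set ys. {v, y} \<notin> B"
  shows "ear_good B (v # ys)"
proof (cases ys rule: rev_cases)
  case Nil
  then show ?thesis by (simp add: ear_good.small)
next
  case (snoc zs w)
  show ?thesis
    using ear_good_fan_left[of B v w "[]" zs] assms snoc by (simp add: ear_good.small)
qed

text \<open>Serves to undo a relabelling: a chord whose image is outside the image of
  \<open>B\<close> is itself outside \<open>B\<close>, so every ear cut pulls back along
  \<open>f\<close>.\<close>

lemma ear_good_map:
  assumes "inj_on f A" "B \<subseteq> Pow A"
  shows "ear_good (image f ` B) ys \<Longrightarrow> ys = map f xs \<Longrightarrow> set xs \<subseteq> A \<Longrightarrow> ear_good B xs"
proof (induction arbitrary: xs rule: ear_good.induct)
  case (small ys)
  then show ?case by (intro ear_good.small) simp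
next
  case (ear a b ys v)
  from ear.prems obtain a' v' b' xs' where xs: "xs = a' # v' # b' # xs'"
    "a = f a'" "v = f v'" "b = f b'" "ys = map f xs'"
    by (auto simp: Cons_eq_map_conv)
  have "ear_good B (a' # b' # xs')"
    using ear.IH[of "a' # b' # xs'"] xs ear.prems by simp
  moreover have "{a', b'} \<notin> B" using ear.hyps(1) xs imageI[of "{a', b'}" B "image f"] by auto
  ultimately show ?case using xs ear.hyps(2) ear_good.ear[of a' b' B xs' v'] by simp
next
  case (rot ys y)
  then obtain x' xs' where xs: "xs = x' # xs'" "y = f x'" "ys = map f xs'"
    by (auto simp: Cons_eq_map_conv)
  have "ear_good B (xs' @ [x'])"
    using rot.IH[of "xs' @ [x']"] xs rot.prems by simp
  then show ?case unfolding xs by (rule ear_good.rot)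
qed

section \<open>Counting blocking edges\<close>

text \<open>Counting only edges spanned by \<open>xs\<close> makes the induction add up: those
  spanned by the polygon without \<open>v\<close> do not include the extra edge at
  \<open>v\<close>.\<close>

lemma card_blocking_ge:
  assumes "\<not> ear_good B xs" "distinct xs" "finite B"
  shows "length xs \<le> card {e\<in>B. e \<subseteq> set xs} + 2"
  using assms
proof (induction "length xs" arbitrary: xs)
  case 0
  then show ?case by simp
next
  case (Suc n)
  let ?E = "\<lambda>xs. {e\<in>B. e \<subseteq> set xs}"
  show ?case
  \<comment> \<open>As \<open>length xs = Suc n\<close>, these are the \<open>length xs - 2\<close>
    chords \<open>(j, j + 2)\<close> without wrap-around; they are distinct, so all of them lying in
    \<open>B\<close> is enough.\<close>
  proof (cases "\<forall>j<n - 1. {xs ! j, xs ! (j + 2)} \<in> B")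
    case True
    let ?f = "\<lambda>j. {xs ! j, xs ! (j + 2)}"
    have "inj_on ?f {..<n - 1}"
      using Suc.hyps(2) Suc.prems(2)
      by (auto intro!: inj_onI simp: doubleton_eq_iff nth_eq_iff_index_eq)
    then have "n - 1 = card (?f ` {..<n - 1})" by (simp add: card_image)
    also have "\<dots> \<le> card (?E xs)"
      using True Suc.hyps(2) Suc.prems(3)
      by (intro card_mono) auto
    finally show ?thesis using Suc.hyps(2) by simp
  next
    case False
    then obtain j where j: "j < n - 1" "{xs ! j, xs ! (j + 2)} \<notin> B" by auto
    define v P Q where "v = xs ! Suc j" and "P = take (j + 1) xs" and "Q = drop (j + 2) xs"
    define ys where "ys = Q @ P"
    have split: "xs = P @ v # Q"
      unfolding P_def Q_def v_def using id_take_nth_drop[of "Suc j" xs] j Suc.hyps(2) by simp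
    have last: "last ys = xs ! j"
      unfolding ys_def P_def using j Suc.hyps(2) by (simp add: last_append take_Suc_conv_app_nth)
    have hd: "hd ys = xs ! (j + 2)"
      unfolding ys_def Q_def using j Suc.hyps(2) by (auto simp: hd_append hd_drop_conv_nth)
    have "\<not> ear_good B (P @ v # Q)" using Suc.prems(1) split by simp
    then have notgood: "\<not> ear_good B (v # ys)"
      using ear_good_append_commute[of B "v # Q" P] ys_def by auto
    then have 1: "\<not> ear_good B ys" using ear_good_cut[of B ys v] j last hd by auto
    have d: "distinct (v # ys)" and sets: "set xs = insert v (set ys)" and "length ys = n"
      using Suc.prems(2) Suc.hyps(2) unfolding ys_def split by auto
    then have IH: "n \<le> card (?E ys) + 2" using Suc.hyps(1)[of ys] 1 d Suc.prems(3) by simp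
    obtain y where y: "y \<in> set ys" "{v, y} \<in> B" using notgood ear_good_fan[of ys v B] by auto
    have vy: "{v, y} \<in> ?E xs" using sets y by auto
    have "?E ys \<subseteq> ?E xs - {{v, y}}" using sets d by auto
    then have "card (?E ys) \<le> card (?E xs - {{v, y}})"
      by (rule card_mono[rotated]) (simp add: Suc.prems(3))
    also have "\<dots> < card (?E xs)"
      by (rule card_Diff1_less[OF _ vy]) (simp add: Suc.prems(3))
    finally have "card (?E ys) < card (?E xs)" .
    then show ?thesis using IH Suc.hyps(2) by simp
  qed
qed

text \<open>Without \<open>v\<close> the polygon is still blocked, which takes at least
  \<open>length ys - 2\<close> edges avoiding \<open>v\<close>. The bound on \<open>card B\<close>
  leaves room for one edge at \<open>v\<close>, and the fan at \<open>v\<close> forces one.\<close>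

lemma unique_edge:
  assumes "\<not> ear_good B (v # ys)" "distinct (v # ys)" "finite B"
    and "card B + 1 \<le> length ys" "{last ys, hd ys} \<notin> B"
  obtains t where "t \<in> set ys" "{v, t} \<in> B" "\<And>e. e \<in> B \<Longrightarrow> v \<in> e \<Longrightarrow> e = {v, t}"
proof -
  obtain t where t: "t \<in> set ys" "{v, t} \<in> B" using assms(1) ear_good_fan[of ys v B] by auto
  have "\<not> ear_good B ys" using ear_good_cut[of B ys v] assms(1,5) by auto
  then have lb: "length ys \<le> card {e\<in>B. e \<subseteq> set ys} + 2"
    using card_blocking_ge[of B ys] assms by simp
  have "e = {v, t}" if e: "e \<in> B" "v \<in> e" for e
  proof (rule ccontr)
    assume "e \<noteq> {v, t}"
    then have "card {e, {v, t}} = 2" by simp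
    moreover have "{e\<in>B. e \<subseteq> set ys} \<subseteq> B - {e, {v, t}}" using assms(2) e by auto
    then have "card {e\<in>B. e \<subseteq> set ys} \<le> card (B - {e, {v, t}})"
      using assms(3) by (intro card_mono) auto
    moreover have "card (B - {e, {v, t}}) = card B - card {e, {v, t}}"
      using e t by (intro card_Diff_subset) auto
    moreover have "card {e, {v, t}} \<le> card B" using e t assms(3) by (intro card_mono) auto
    ultimately show False using lb assms(4) by linarith
  qed
  with t show ?thesis using that by blast
qed

section \<open>Triangulations as maximal sets of non-interleaved pairs\<close>

text \<open>Strict cyclic order: going upwards from \<open>a\<close> with wrap-around,
  \<open>b\<close> is met before \<open>c\<close>.\<close>

definition cyc :: "nat \<Rightarrow> nat \<Rightarrow> nat \<Rightarrow> bool" where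
  "cyc a b c \<longleftrightarrow> a < b \<and> b < c \<or> b < c \<and> c < a \<or> c < a \<and> a < b"

text \<open>The combinatorial counterpart of crossing: the ends of each pair separate those of the
  other.\<close>

definition interleaved :: "nat set \<Rightarrow> nat set \<Rightarrow> bool" where
  "interleaved e f \<longleftrightarrow> (\<exists>a b c d. e = {a, b} \<and> f = {c, d} \<and> cyc a c b \<and> cyc b d a)"

lemma interleaved_iff:
  "interleaved {a, b} {c, d} \<longleftrightarrow> cyc a c b \<and> cyc b d a \<or> cyc a d b \<and> cyc b c a"
proof
  assume "interleaved {a, b} {c, d}"
  then obtain a' b' c' d' where "{a, b} = {a', b'}" "{c, d} = {c', d'}" "cyc a' c' b'" "cyc b' d' a'"
    unfolding interleaved_def by auto
  then show "cyc a c b \<and> cyc b d a \<or> cyc a d b \<and> cyc b c a"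
    by (auto simp: doubleton_eq_iff)
next
  assume "cyc a c b \<and> cyc b d a \<or> cyc a d b \<and> cyc b c a"
  then show "interleaved {a, b} {c, d}"
    unfolding interleaved_def by (auto simp: insert_commute)
qed

lemma interleaved_iff_less:
  assumes "a < b" "c < d"
  shows "interleaved {a, b} {c, d} \<longleftrightarrow> a < c \<and> c < b \<and> b < d \<or> c < a \<and> a < d \<and> d < b"
  unfolding interleaved_iff cyc_def using assms by auto

lemma interleaved_commute: "interleaved e f \<Longrightarrow> interleaved f e"
proof -
  assume "interleaved e f"
  then obtain a b c d where ef: "e = {a, b}" "f = {c, d}" "cyc a c b" "cyc b d a"
    unfolding interleaved_def by blast
  then have "interleaved {c, d} {a, b}"
    unfolding interleaved_iff cyc_def by auto
  then show ?thesis using ef by simp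
qed

definition pairs :: "'a set \<Rightarrow> 'a set set" where
  "pairs V = {e. \<exists>x\<in>V. \<exists>y\<in>V. x \<noteq> y \<and> e = {x, y}}"

lemma doubleton_in_pairs_iff: "{a, b} \<in> pairs V \<longleftrightarrow> a \<in> V \<and> b \<in> V \<and> a \<noteq> b"
  unfolding pairs_def by (auto simp: doubleton_eq_iff)

text \<open>A chord is a diagonal exactly when some chord crosses it; this avoids a successor
  function on \<open>V\<close>, which would change whenever a vertex is inserted.\<close>

definition proper_diagonals :: "nat set \<Rightarrow> nat set set" where
  "proper_diagonals V = {e \<in> pairs V. \<exists>f\<in>pairs V. interleaved e f}"

definition comb_triangulation :: "nat set \<Rightarrow> nat set set \<Rightarrow> bool" where
  "comb_triangulation V T \<longleftrightarrow>
     T \<subseteq> proper_diagonals V \<and> (\<forall>e\<in>T. \<forall>f\<in>T. \<not> interleaved e f) \<and>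
     (\<forall>e\<in>proper_diagonals V - T. \<exists>f\<in>T. interleaved e f)"

lemma pairs_insert: "pairs (insert v V) = pairs V \<union> {{v, z} | z. z \<in> V \<and> z \<noteq> v}"
  unfolding pairs_def by (auto simp: insert_commute)

lemma proper_diagonals_small:
  assumes "finite V" "card V \<le> 3"
  shows "proper_diagonals V = {}"
proof (rule ccontr)
  assume "proper_diagonals V \<noteq> {}"
  then obtain e f where "e \<in> pairs V" "f \<in> pairs V" "interleaved e f"
    unfolding proper_diagonals_def by auto
  then obtain a b c d where "cyc a c b" "cyc b d a" "{a, b} \<in> pairs V" "{c, d} \<in> pairs V"
    unfolding interleaved_def by blast
  moreover from this have "{a, b, c, d} \<subseteq> V" by (auto simp: doubleton_in_pairs_iff)
  moreover from calculation have "card {a, b, c, d} = 4" unfolding cyc_def by auto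
  ultimately show False using assms card_mono[of V "{a, b, c, d}"] by linarith
qed

text \<open>Inserting the ear tip \<open>v\<close> between the neighbours \<open>a\<close> and
  \<open>b\<close> turns the side \<open>{a, b}\<close> into a diagonal, with \<open>{v, c}\<close>
  crossing it. Every diagonal at \<open>v\<close> crosses \<open>{a, b}\<close>, and the old
  diagonals are handled by the maximality of \<open>T\<close>.\<close>

lemma comb_triangulation_insert:
  assumes T: "comb_triangulation V T"
    and ab: "a \<in> V" "b \<in> V" and v: "v \<notin> V" "cyc a v b"
    and rest: "\<And>z. z \<in> V \<Longrightarrow> z \<noteq> a \<Longrightarrow> z \<noteq> b \<Longrightarrow> cyc v b z \<and> cyc a v z"
    and other: "c \<in> V" "c \<noteq> a" "c \<noteq> b"
  shows "comb_triangulation (insert v V) (insert {a, b} T)"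
proof -
  have "a \<noteq> b" using v(2) unfolding cyc_def by auto
  have T_pairs: "T \<subseteq> pairs V" using T unfolding comb_triangulation_def proper_diagonals_def by auto
  have ab_free: "\<not> interleaved {a, b} e" if e: "e \<in> pairs V" for e
  proof -
    obtain x y where xy: "x \<in> V" "y \<in> V" "e = {x, y}" using e unfolding pairs_def by auto
    have "\<not> cyc a z b" if "z \<in> V" for z
    proof (cases "z = a \<or> z = b")
      case False
      with rest[OF that] v(2) show ?thesis unfolding cyc_def by linarith
    qed (auto simp: cyc_def)
    then show ?thesis using xy interleaved_iff by auto
  qed
  have ab_cross: "interleaved {a, b} {v, z}" if "z \<in> V" "z \<noteq> a" "z \<noteq> b" for z
  proof -
    have "cyc b z a" using rest[OF that] v(2) unfolding cyc_def by linarith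
    then show ?thesis using v(2) unfolding interleaved_iff by auto
  qed
  have va_free: "\<not> interleaved {v, z} e" if z: "z \<in> {a, b}" and e: "e \<in> pairs V" for z e
  proof -
    obtain x y where xy: "x \<in> V" "y \<in> V" "e = {x, y}" using e unfolding pairs_def by auto
    have "\<not> cyc a w v" if "w \<in> V" for w
    proof (cases "w = a \<or> w = b")
      case False
      with rest[OF that] v(2) show ?thesis unfolding cyc_def by linarith
    qed (use v(2) in \<open>auto simp: cyc_def\<close>)
    moreover have "\<not> cyc v w b" if "w \<in> V" for w
    proof (cases "w = a \<or> w = b")
      case False
      with rest[OF that] v(2) show ?thesis unfolding cyc_def by linarith
    qed (use v(2) in \<open>auto simp: cyc_def\<close>)
    ultimately show ?thesis using z xy by (auto simp: interleaved_iff)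
  qed
  \<comment> \<open>If \<open>e\<close> is crossed only by pairs at \<open>v\<close>, the end
    \<open>v\<close> of such an \<open>f\<close> can be slid to a neighbour \<open>w\<close> in
    \<open>{a, b}\<close> with \<open>e\<close> still crossed, unless \<open>w\<close> is an end of
    \<open>e\<close>. Hence both \<open>a\<close> and \<open>b\<close> are ends of
    \<open>e\<close>.\<close>
  have old_or_ab: "e \<in> proper_diagonals V \<or> e = {a, b}"
    if e: "e \<in> pairs V" and f: "f \<in> pairs (insert v V)" "interleaved e f" for e f
  proof (rule ccontr)
    assume neg: "\<not> ?thesis"
    then have "f \<notin> pairs V" using e f unfolding proper_diagonals_def by auto
    then obtain z where z: "z \<in> V" "f = {v, z}" using f(1) unfolding pairs_insert by auto
    obtain x y where xy: "x \<in> V" "y \<in> V" "x \<noteq> y" "e = {x, y}" using e unfolding pairs_def by auto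
    have in_e: "w \<in> e" if w: "w = a \<or> w = b" for w
    proof (rule ccontr)
      assume "w \<notin> e"
      then have "interleaved {x, y} {w, z} \<and> w \<noteq> z"
        using f(2) w z xy v(2) \<open>a \<noteq> b\<close> rest[OF z(1)] rest[OF xy(1)] rest[OF xy(2)]
        unfolding \<open>f = {v, z}\<close> \<open>e = {x, y}\<close> interleaved_iff cyc_def
        by simp (smt (verit) less_trans not_less_iff_gr_or_eq)
      moreover from this have "{w, z} \<in> pairs V"
        using w ab z(1) by (auto simp: doubleton_in_pairs_iff)
      ultimately show False using neg e xy(4) unfolding proper_diagonals_def by auto
    qed
    then have "{a, b} \<subseteq> e" by auto
    then have "e = {a, b}" using xy \<open>a \<noteq> b\<close> by auto
    then show False using neg by simp
  qed
  show ?thesis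
    unfolding comb_triangulation_def
  proof (intro conjI ballI)
    have "proper_diagonals V \<subseteq> proper_diagonals (insert v V)"
      unfolding proper_diagonals_def pairs_insert by auto
    moreover have "{a, b} \<in> pairs V" using ab \<open>a \<noteq> b\<close> unfolding pairs_def by auto
    moreover have "{v, c} \<in> pairs (insert v V)"
      using other v(1) unfolding pairs_insert by auto
    ultimately show "insert {a, b} T \<subseteq> proper_diagonals (insert v V)"
      using T ab_cross[OF other] unfolding comb_triangulation_def proper_diagonals_def pairs_insert
      by blast
  next
    fix e f assume "e \<in> insert {a, b} T" "f \<in> insert {a, b} T"
    moreover have "\<not> interleaved {a, b} {a, b}" unfolding interleaved_iff cyc_def by auto
    ultimately show "\<not> interleaved e f"
      using T T_pairs ab_free interleaved_commute unfolding comb_triangulation_def by blast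
  next
    fix e assume e: "e \<in> proper_diagonals (insert v V) - insert {a, b} T"
    then obtain f where f: "f \<in> pairs (insert v V)" "interleaved e f"
      unfolding proper_diagonals_def by auto
    show "\<exists>f\<in>insert {a, b} T. interleaved e f"
    proof (cases "e \<in> pairs V")
      case True
      then have "e \<in> proper_diagonals V - T" using old_or_ab[OF True f] e by auto
      then show ?thesis using T unfolding comb_triangulation_def by auto
    next
      case False
      then obtain z where z: "z \<in> V" "z \<noteq> v" "e = {v, z}"
        using e unfolding proper_diagonals_def pairs_insert by auto
      have "f \<in> pairs V"
      proof (rule ccontr)
        assume "f \<notin> pairs V"
        then obtain y where "f = {v, y}" using f(1) unfolding pairs_insert by auto
        then show False using f(2) z(3) by (auto simp: interleaved_iff cyc_def)
      qed
      then have "z \<noteq> a" "z \<noteq> b" using va_free[of z f] f(2) z by auto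
      then show ?thesis using ab_cross z interleaved_commute by blast
    qed
  qed
qed

section \<open>Lists in cyclic order\<close>

text \<open>The order seen from the head determines the cyclic order. It says nothing about lists of
  two entries, hence the separate \<open>distinct\<close>.\<close>

fun cyc_sorted :: "nat list \<Rightarrow> bool" where
  "cyc_sorted [] \<longleftrightarrow> True"
| "cyc_sorted (x # xs) \<longleftrightarrow> sorted_wrt (cyc x) xs \<and> distinct (x # xs)"

lemma cyc_sorted_rotate1:
  assumes "cyc_sorted (x # xs)"
  shows "cyc_sorted (xs @ [x])"
proof (cases xs)
  case (Cons y zs)
  have "sorted_wrt (cyc y) zs"
  proof (rule sorted_wrt_mono_rel[of _ "cyc x"])
    show "sorted_wrt (cyc x) zs" using assms Cons by simp
    fix p q assume "p \<in> set zs" "q \<in> set zs" "cyc x p q"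
    moreover from this have "cyc x y p" "cyc x y q" using assms Cons by auto
    ultimately show "cyc y p q" unfolding cyc_def by linarith
  qed
  moreover have "cyc y z x" if "z \<in> set zs" for z
  proof -
    have "cyc x y z" using assms Cons that by auto
    then show ?thesis unfolding cyc_def by linarith
  qed
  ultimately show ?thesis using assms Cons by (auto simp: sorted_wrt_append)
qed simp

lemma ear_good_imp_comb_triangulation:
  assumes "ear_good B xs" "cyc_sorted xs"
  shows "\<exists>T. comb_triangulation (set xs) T \<and> T \<inter> B = {}"
  using assms
proof (induction rule: ear_good.induct)
  case (small xs)
  then have "proper_diagonals (set xs) = {}"
    by (intro proper_diagonals_small) (auto intro: le_trans[OF card_length])
  then show ?case unfolding comb_triangulation_def by (intro exI[of _ "{}"]) auto
next
  case (ear a b xs v)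
  then obtain T where T: "comb_triangulation (set (a # b # xs)) T" "T \<inter> B = {}" by auto
  \<comment> \<open>The premise \<open>xs \<noteq> []\<close> of the rule \<open>ear\<close>
    provides a fourth vertex, which makes \<open>{a, b}\<close> a diagonal rather than a
    side.\<close>
  obtain c where c: "c \<in> set xs" using ear.hyps(2) by (cases xs) auto
  have "comb_triangulation (insert v (set (a # b # xs))) (insert {a, b} T)"
  proof (rule comb_triangulation_insert[where c = c, OF T(1)])
    fix z assume "z \<in> set (a # b # xs)" "z \<noteq> a" "z \<noteq> b"
    then have "cyc a v b" "cyc a v z" "cyc a b z" using ear.prems by auto
    then show "cyc v b z \<and> cyc a v z" unfolding cyc_def by linarith
  qed (use ear.prems c in auto)
  moreover have "insert v (set (a # b # xs)) = set (a # v # b # xs)" by auto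
  ultimately show ?case using T(2) ear.hyps(1) by (metis Int_insert_left)
next
  case (rot xs x)
  then show ?case using cyc_sorted_rotate1[of x xs] by simp
qed

lemma cyc_sorted_upt: "cyc_sorted [0..<n]"
proof (cases n)
  case (Suc k)
  have "sorted_wrt (cyc 0) [1..<n]"
    by (rule sorted_wrt_mono_rel[OF _ sorted_wrt_upt]) (auto simp: cyc_def)
  then show ?thesis using Suc upt_conv_Cons[of 0 n] by simp
qed simp

section \<open>Crossing segments in convex position\<close>

text \<open>The definition fixes the sign only for triples containing the two ends of a side.
  Induction on the last label extends it: the step from \<open>l\<close> to \<open>k = Suc l\<close>
  compares the points \<open>Suc i\<close>, \<open>j\<close>, \<open>l\<close>, \<open>k\<close> as
  seen from \<open>p i\<close>.\<close>

lemma convex_ngon_orient: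
  assumes "convex_ngon n p" "i < j" "j < k" "k < n"
  shows "orient (p i) (p j) (p k) < 0"
proof -
  have side: "orient (p i) (p (Suc i)) (p k) < 0"
    if "i < n" "Suc i < n" "k < n" "k \<noteq> i" "k \<noteq> Suc i" for i k
    using assms(1) that unfolding convex_ngon_def by (metis Suc_eq_plus1 mod_less)
  have "orient (p i) (p j) (p k) < 0" if "i < j" "j < k" "k < n" for i j k
    using that(2,3,1)
  proof (induction k rule: less_induct)
    case (less k)
    then obtain l where l: "k = Suc l" by (cases k) auto
    show ?case
    proof (cases "l = j")
      case True
      then have "orient (p j) (p k) (p i) < 0" using side[of j i] less.prems l by auto
      then show ?thesis unfolding orient_def by (simp add: algebra_simps)
    next
      case False
      show ?thesis
      proof (cases "j = Suc i")
        case True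
        then show ?thesis using side[of i k] less.prems l by auto
      next
        case not_next: False
        let ?o = "\<lambda>x y. orient (p i) (p x) (p y)"
        have jl: "?o j l < 0" using less.IH[of l] less.prems l False by auto
        have "orient (p l) (p k) (p i) < 0" using side[of l i] less.prems l by auto
        then have lk: "?o l k < 0" unfolding orient_def by (simp add: algebra_simps)
        have 1: "?o (Suc i) x < 0" if "x < n" "x > Suc i" for x
          using side[of i x] that less.prems by auto
        \<comment> \<open>Three-term Pluecker relation for the vectors from \<open>p i\<close>.\<close>
        have "?o (Suc i) l * ?o j k = ?o (Suc i) j * ?o l k + ?o (Suc i) k * ?o j l"
          unfolding orient_def by (simp add: algebra_simps)
        moreover have "?o (Suc i) j * ?o l k > 0"
          using 1[of j] lk less.prems not_next by (intro mult_neg_neg) auto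
        moreover have "?o (Suc i) k * ?o j l > 0"
          using 1[of k] jl less.prems not_next by (intro mult_neg_neg) auto
        ultimately have "?o (Suc i) l * ?o j k > 0" by linarith
        moreover have "?o (Suc i) l < 0" using 1[of l] less.prems l False by auto
        ultimately show ?thesis by (simp add: zero_less_mult_iff)
      qed
    qed
  qed
  then show ?thesis using assms by blast
qed

lemma open_segments_meet:
  assumes "orient c d a < 0" "orient c d b > 0" "orient a b c > 0" "orient a b d < 0"
  shows "open_segment a b \<inter> open_segment c d \<noteq> {}"
proof -
  \<comment> \<open>\<open>orient c d\<close> is affine along the segment from \<open>a\<close> to
    \<open>b\<close>, and \<open>s\<close> is the parameter of its zero; \<open>t\<close> is found
    likewise on the other segment.\<close>
  define s where "s = orient c d a / (orient c d a - orient c d b)"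
  define t where "t = orient a b c / (orient a b c - orient a b d)"
  have s: "0 < s" "s < 1" unfolding s_def using assms by (auto simp: field_simps)
  have t: "0 < t" "t < 1" unfolding t_def using assms by (auto simp: field_simps)
  have ab: "a \<noteq> b" using assms(3) unfolding orient_def by auto
  have cd: "c \<noteq> d" using assms(2) unfolding orient_def by auto
  \<comment> \<open>Up to sign the common denominator of \<open>s\<close> and \<open>t\<close>;
    multiplying by it reduces the equality of the two points to polynomial identities.\<close>
  define W where "W = orient a b c - orient a b d"
  have W: "W \<noteq> 0" unfolding W_def using assms by simp
  have sW: "s * W = - orient c d a"
  proof -
    have "orient c d a - orient c d b = - W"
      unfolding W_def orient_def by (simp add: algebra_simps)
    then show ?thesis using W unfolding s_def by simp
  qed
  have tW: "t * W = orient a b c" using W unfolding t_def W_def by simp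
  have "(1 - s) *\<^sub>R a + s *\<^sub>R b = (1 - t) *\<^sub>R c + t *\<^sub>R d"
  proof -
    have "(1 - s) * a $ k + s * b $ k = (1 - t) * c $ k + t * d $ k" if k: "k = 1 \<or> k = 2" for k :: 2
    proof -
      have "W * ((1 - s) * a $ k + s * b $ k) = W * a $ k + (s * W) * (b $ k - a $ k)"
        by (simp add: algebra_simps)
      also have "\<dots> = W * c $ k + (t * W) * (d $ k - c $ k)"
        unfolding sW tW using k unfolding W_def orient_def by (auto simp: algebra_simps)
      also have "\<dots> = W * ((1 - t) * c $ k + t * d $ k)"
        by (simp add: algebra_simps)
      finally show ?thesis using W by simp
    qed
    then show ?thesis by (simp add: vec_eq_iff forall_2)
  qed
  moreover have "(1 - s) *\<^sub>R a + s *\<^sub>R b \<in> open_segment a b"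
    using s ab unfolding in_segment by auto
  moreover have "(1 - t) *\<^sub>R c + t *\<^sub>R d \<in> open_segment c d"
    using t cd unfolding in_segment by auto
  ultimately show ?thesis by auto
qed

text \<open>\<open>orient a b\<close> vanishes on the line through \<open>a\<close> and
  \<open>b\<close>, but inside the other segment it is a positive combination of two values of
  weakly equal sign, not both zero.\<close>

lemma open_segments_disjoint:
  assumes "orient a b c \<ge> 0 \<and> orient a b d \<ge> 0 \<or> orient a b c \<le> 0 \<and> orient a b d \<le> 0"
    and "orient a b c \<noteq> 0 \<or> orient a b d \<noteq> 0"
  shows "open_segment a b \<inter> open_segment c d = {}"
proof (rule ccontr)
  assume "\<not> ?thesis"
  then obtain s t where st: "0 < t" "t < 1"
    "(1 - s) *\<^sub>R a + s *\<^sub>R b = (1 - t) *\<^sub>R c + t *\<^sub>R d"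
    unfolding in_segment disjoint_iff by auto
  have "orient a b ((1 - s) *\<^sub>R a + s *\<^sub>R b) = 0"
    unfolding orient_def by (simp add: algebra_simps)
  moreover have "orient a b ((1 - t) *\<^sub>R c + t *\<^sub>R d) = (1 - t) * orient a b c + t * orient a b d"
    unfolding orient_def by (simp add: algebra_simps)
  ultimately have eq: "(1 - t) * orient a b c + t * orient a b d = 0" using st(3) by simp
  have sgn: "(1 - t) * x + t * y > 0" if "x \<ge> 0" "y \<ge> 0" "x \<noteq> 0 \<or> y \<noteq> 0" for x y
  proof (cases "x = 0")
    case True
    then show ?thesis using that st by simp
  next
    case False
    then show ?thesis using that st by (intro add_pos_nonneg) auto
  qed
  from assms(1) show False
  proof
    assume "orient a b c \<ge> 0 \<and> orient a b d \<ge> 0"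
    then show False using sgn[of "orient a b c" "orient a b d"] eq assms(2) by simp
  next
    assume "orient a b c \<le> 0 \<and> orient a b d \<le> 0"
    then show False using sgn[of "- orient a b c" "- orient a b d"] eq assms(2) by simp
  qed
qed

section \<open>Crossing read off from the labels\<close>

lemma edges_eq_pairs: "edges n = pairs {..<n}"
  unfolding edges_def pairs_def by auto

lemma edges_obtain_less:
  assumes "e \<in> edges n"
  obtains a b where "e = {a, b}" "a < b" "b < n"
proof -
  obtain a b where "e = {a, b}" "a < n" "b < n" "a \<noteq> b"
    using assms unfolding edges_def by auto
  then show ?thesis using that[of a b] that[of b a]
    by (cases "a < b") (auto simp: insert_commute)
qed

lemma segments_meet_iff:
  assumes "convex_ngon n p" "a < b" "b < n" "c < d" "d < n" "{a, b} \<noteq> {c, d}"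
  shows "open_segment (p a) (p b) \<inter> open_segment (p c) (p d) \<noteq> {} \<longleftrightarrow>
    a < c \<and> c < b \<and> b < d \<or> c < a \<and> a < d \<and> d < b"
proof -
  have neg: "orient (p i) (p j) (p k) < 0" if "i < j" "j < k" "k < n" for i j k
    using convex_ngon_orient[OF assms(1)] that by blast
  have cyc_rot: "orient x y z = orient y z x" and swap: "orient x y z = - orient x z y" for x y z
    unfolding orient_def by (simp_all add: algebra_simps)
  have in_pos: "orient (p i) (p j) (p k) > 0" if "i < k" "k < j" "j < n" for i j k
    using neg[of i k j] that swap[of "p i" "p j" "p k"] by simp
  have out_neg: "orient (p i) (p j) (p k) < 0" if "i < j" "k < i" "j < n" for i j k
    using neg[of k i j] that cyc_rot[of "p k" "p i" "p j"] by simp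
  have zero: "orient x y x = 0" "orient x y y = 0" for x y
    unfolding orient_def by simp_all
  have meet: "open_segment (p i) (p j) \<inter> open_segment (p k) (p l) \<noteq> {}"
    if "i < k" "k < j" "j < l" "l < n" for i j k l
    using that by (intro open_segments_meet) (auto intro: neg in_pos out_neg)
  show ?thesis
  proof
    assume "a < c \<and> c < b \<and> b < d \<or> c < a \<and> a < d \<and> d < b"
    then show "open_segment (p a) (p b) \<inter> open_segment (p c) (p d) \<noteq> {}"
      using meet[of a c b d] meet[of c a d b] assms by auto
  next
    assume meets: "open_segment (p a) (p b) \<inter> open_segment (p c) (p d) \<noteq> {}"
    show "a < c \<and> c < b \<and> b < d \<or> c < a \<and> a < d \<and> d < b"
    proof (rule ccontr)
      assume not: "\<not> ?thesis"
      let ?o = "\<lambda>k. orient (p a) (p b) (p k)"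
      have o_in: "?o k \<ge> 0" if "a \<le> k" "k \<le> b" for k
        using that in_pos[of a k b] zero assms by (cases "k = a \<or> k = b") (auto intro: less_imp_le)
      have o_out: "?o k \<le> 0" if "k \<le> a \<or> b \<le> k" "k < n" for k
        using that out_neg[of a b k] neg[of a b k] zero assms
        by (cases "k = a \<or> k = b") (auto intro: less_imp_le)
      have o_nz: "?o k \<noteq> 0" if "k \<noteq> a" "k \<noteq> b" "k < n" for k
        using that in_pos[of a k b] out_neg[of a b k] neg[of a b k] assms
        by (metis less_irrefl linorder_neqE_nat)
      \<comment> \<open>Without interleaving, \<open>c\<close> and \<open>d\<close> lie in the same
        closed arc between \<open>a\<close> and \<open>b\<close>, hence weakly on one side of the
        line. As the edges differ, one of them is off the line.\<close>
      consider "a \<le> c" "d \<le> b" | "c \<le> a \<or> b \<le> c" "d \<le> a \<or> b \<le> d"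
        using not assms(2,4) by linarith
      then have "?o c \<ge> 0 \<and> ?o d \<ge> 0 \<or> ?o c \<le> 0 \<and> ?o d \<le> 0"
        by cases (use o_in o_out assms in auto)
      moreover have "c \<noteq> a \<and> c \<noteq> b \<or> d \<noteq> a \<and> d \<noteq> b"
        using assms by (cases "c = a"; cases "c = b"; cases "d = a"; cases "d = b") auto
      then have "?o c \<noteq> 0 \<or> ?o d \<noteq> 0"
        using o_nz[of c] o_nz[of d] assms by auto
      ultimately show False using open_segments_disjoint meets by blast
    qed
  qed
qed

lemma crosses_iff_interleaved:
  assumes "convex_ngon n p" "e \<in> edges n" "f \<in> edges n"
  shows "crosses p e f \<longleftrightarrow> interleaved e f"
proof -
  obtain a b where e: "e = {a, b}" "a < b" "b < n" using edges_obtain_less[OF assms(2)] .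
  obtain c d where f: "f = {c, d}" "c < d" "d < n" using edges_obtain_less[OF assms(3)] .
  have "crosses p e f \<longleftrightarrow> e \<noteq> f \<and> open_segment (p a) (p b) \<inter> open_segment (p c) (p d) \<noteq> {}"
  proof
    assume "crosses p e f"
    then obtain a' b' c' d' where "e \<noteq> f" "{a, b} = {a', b'}" "{c, d} = {c', d'}"
      "open_segment (p a') (p b') \<inter> open_segment (p c') (p d') \<noteq> {}"
      unfolding crosses_def e(1) f(1) by blast
    then show "e \<noteq> f \<and> open_segment (p a) (p b) \<inter> open_segment (p c) (p d) \<noteq> {}"
      by (auto simp: doubleton_eq_iff open_segment_commute)
  next
    assume "e \<noteq> f \<and> open_segment (p a) (p b) \<inter> open_segment (p c) (p d) \<noteq> {}"
    then show "crosses p e f" unfolding crosses_def using e(1) f(1) by blast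
  qed
  also have "\<dots> \<longleftrightarrow> a < c \<and> c < b \<and> b < d \<or> c < a \<and> a < d \<and> d < b"
  proof (cases "e = f")
    case True
    then have "a = c" "b = d" using e f by (auto simp: doubleton_eq_iff)
    then show ?thesis using True by simp
  next
    case False
    then show ?thesis using segments_meet_iff[OF assms(1) e(2,3) f(2,3)] e(1) f(1) by blast
  qed
  also have "\<dots> \<longleftrightarrow> interleaved e f"
    unfolding e(1) f(1) using interleaved_iff_less[OF e(2) f(2)] by simp
  finally show ?thesis .
qed

lemma diagonals_eq: "diagonals n = proper_diagonals {..<n}"
proof (intro equalityI subsetI)
  fix e assume "e \<in> diagonals n"
  then obtain i j where "e = {i, j}" "i < n" "j < n" "i \<noteq> j" "edge_order n i j \<ge> 2"
    unfolding diagonals_def by auto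
  then obtain a b where e: "e = {a, b}" "a < b" "b < n" "edge_order n a b \<ge> 2"
    by (cases "i < j") (auto simp: insert_commute edge_order_def abs_minus_commute)
  then have ab: "b \<ge> a + 2" "b - a + 2 \<le> n" unfolding edge_order_def by auto
  \<comment> \<open>\<open>a + 1\<close> lies strictly between \<open>a\<close> and
    \<open>b\<close>. The other end lies outside: it is \<open>a - 1\<close>, or
    \<open>b + 1\<close> when \<open>a = 0\<close>, and then order at least 2 gives
    \<open>b + 1 < n\<close>.\<close>
  have "interleaved {a, b} {a + 1, if a = 0 then b + 1 else a - 1}"
    using ab e unfolding interleaved_iff cyc_def by auto
  moreover have "{a + 1, if a = 0 then b + 1 else a - 1} \<in> pairs {..<n}"
    using ab e by (auto simp: doubleton_in_pairs_iff)
  ultimately show "e \<in> proper_diagonals {..<n}"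
    using e unfolding proper_diagonals_def by (auto simp: doubleton_in_pairs_iff)
next
  fix e assume "e \<in> proper_diagonals {..<n}"
  then obtain f where ef: "e \<in> edges n" "f \<in> edges n" "interleaved e f"
    unfolding proper_diagonals_def edges_eq_pairs by auto
  obtain a b where e: "e = {a, b}" "a < b" "b < n" using edges_obtain_less[OF ef(1)] .
  obtain c d where f: "f = {c, d}" "c < d" "d < n" using edges_obtain_less[OF ef(2)] .
  have "a < c \<and> c < b \<and> b < d \<or> c < a \<and> a < d \<and> d < b"
    using ef(3) interleaved_iff_less e f by auto
  then have "edge_order n a b \<ge> 2" unfolding edge_order_def using e f by auto
  then show "e \<in> diagonals n" 
    unfolding diagonals_def using e by (intro CollectI exI[of _ a] exI[of _ b]) auto
qed

lemma diagonals_subset_edges: "diagonals n \<subseteq> edges n"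
  unfolding diagonals_def edges_def by auto

text \<open>The passage from geometry to lists: an ear decomposition avoiding \<open>B\<close> would
  give a geometric triangulation disjoint from \<open>B\<close>.\<close>

lemma blocking_imp_not_ear_good:
  assumes "convex_ngon n p" "blocking_set n p B"
  shows "\<not> ear_good B [0..<n]"
proof
  assume "ear_good B [0..<n]"
  then obtain T where T: "comb_triangulation {..<n} T" "T \<inter> B = {}"
    using ear_good_imp_comb_triangulation cyc_sorted_upt by (metis atLeast_upt)
  have sub: "T \<subseteq> diagonals n" using T(1) unfolding comb_triangulation_def diagonals_eq by auto
  have cr: "crosses p e f \<longleftrightarrow> interleaved e f" if "e \<in> diagonals n" "f \<in> diagonals n" for e f
    using crosses_iff_interleaved[OF assms(1)] that diagonals_subset_edges by blast
  have "triangulation n p T"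
    unfolding triangulation_def noncrossing_diagonals_def
  proof (intro conjI allI impI ballI equalityI subsetI)
    show "\<not> crosses p e f" if "e \<in> T" "f \<in> T" for e f
      using that cr sub T(1) unfolding comb_triangulation_def by blast
  next
    fix T' e assume T': "T' \<subseteq> diagonals n \<and> (\<forall>e\<in>T'. \<forall>f\<in>T'. \<not> crosses p e f)" "T \<subseteq> T'"
      and e: "e \<in> T'"
    show "e \<in> T"
    proof (rule ccontr)
      assume "e \<notin> T"
      then obtain f where "f \<in> T" "interleaved e f"
        using T(1) T' e unfolding comb_triangulation_def diagonals_eq by blast
      then show False using T' e cr by blast
    qed
  qed (use sub in auto)
  then show False using assms(2) T(2) unfolding blocking_set_def by auto
qed

section \<open>A small blocking set\<close>

text \<open>Bounds the size of a blocker from above. The chords are the ears with tips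
  \<open>1\<close> to \<open>n - 2\<close>; the two remaining vertices \<open>0\<close> and
  \<open>n - 1\<close> are adjacent.\<close>

lemma linear_ears_blocking:
  assumes "convex_ngon n p" "n \<ge> 4"
  shows "blocking_set n p ((\<lambda>l. {l, l + 2}) ` {..<n - 2})"
  unfolding blocking_set_def
proof (intro conjI allI impI)
  show "(\<lambda>l. {l, l + 2}) ` {..<n - 2} \<subseteq> edges n" unfolding edges_def by force
  fix T assume T: "triangulation n p T"
  then have sub: "T \<subseteq> diagonals n" and ncp: "\<And>e f. e \<in> T \<Longrightarrow> f \<in> T \<Longrightarrow> \<not> crosses p e f"
    unfolding triangulation_def noncrossing_diagonals_def by auto
  have cr: "crosses p e f \<longleftrightarrow> interleaved e f" if "e \<in> diagonals n" "f \<in> diagonals n" for e f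
    using crosses_iff_interleaved[OF assms(1)] that diagonals_subset_edges by blast
  have nc: "\<not> interleaved e f" if "e \<in> T" "f \<in> T" for e f
    using that ncp cr sub by blast
  \<comment> \<open>A shortest chord of \<open>T\<close>, the side \<open>(0, n - 1)\<close> included, must have length 2.\<close>
  define P where "P d \<longleftrightarrow> (\<exists>i. d \<ge> 2 \<and> i + d < n \<and> ({i, i + d} \<in> T \<or> d = n - 1))" for d
  have "P (n - 1)" unfolding P_def using assms(2) by (intro exI[of _ 0]) auto
  then have "P (LEAST d. P d)" by (rule LeastI)
  then obtain d i where d: "d = (LEAST d. P d)" "d \<ge> 2" "i + d < n" "{i, i + d} \<in> T \<or> d = n - 1"
    unfolding P_def by auto
  have min: "\<not> ({j, j + d'} \<in> T)" if "d' \<ge> 2" "d' < d" for d' j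
  proof
    assume in_T: "{j, j + d'} \<in> T"
    then have "{j, j + d'} \<in> edges n" using sub diagonals_subset_edges by blast
    then have "j + d' < n" unfolding edges_eq_pairs by (simp add: doubleton_in_pairs_iff)
    then have "P d'" unfolding P_def using in_T that by auto
    then show False using not_less_Least that d(1) by blast
  qed
  have "{i, i + 2} \<in> T"
  proof (cases "d = 2")
    case True
    then show ?thesis using d assms(2) by auto
  next
    case False
    have diag: "{i, i + 2} \<in> diagonals n"
      unfolding diagonals_def edge_order_def using d False by fastforce
    \<comment> \<open>An edge of \<open>T\<close> crossing \<open>{i, i + 2}\<close> ends at
      \<open>i + 1\<close>. It either stays between \<open>i\<close> and \<open>i + d\<close>, and
      is shorter than \<open>d\<close>, or it leaves this range and crosses
      \<open>{i, i + d}\<close>. By maximality \<open>{i, i + 2}\<close> is then in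
      \<open>T\<close>.\<close>
    have no_cross: "\<not> interleaved {i, i + 2} f" if f: "f \<in> T" for f
    proof
      assume int: "interleaved {i, i + 2} f"
      have "f \<in> edges n" using f sub diagonals_subset_edges by blast
      then obtain x y where xy: "f = {x, y}" "x < y" "y < n" using edges_obtain_less by blast
      have "x = i + 1 \<and> y > i + 2 \<or> x < i \<and> y = i + 1"
        using int interleaved_iff_less[of i "i + 2" x y] xy by auto
      then show False
      proof
        assume x: "x = i + 1 \<and> y > i + 2"
        show False
        proof (cases "y \<le> i + d")
          case True
          then have "2 \<le> y - x" "y - x < d" using x d(2) by linarith+
          then show False using min[of "y - x" x] xy f by simp
        next
          case False
          then have "{i, i + d} \<in> T" using d xy by auto
          moreover have "interleaved {i, i + d} f"
            using interleaved_iff_less[of i "i + d" x y] x xy d False by auto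
          ultimately show False using nc f by blast
        qed
      next
        assume x: "x < i \<and> y = i + 1"
        then have "{i, i + d} \<in> T" using d xy by auto
        moreover have "interleaved {i, i + d} f"
          using interleaved_iff_less[of i "i + d" x y] x xy d by auto
        ultimately show False using nc f by blast
      qed
    qed
    have "noncrossing_diagonals n p (insert {i, i + 2} T)"
      unfolding noncrossing_diagonals_def
    proof (intro conjI ballI)
      show "insert {i, i + 2} T \<subseteq> diagonals n" using diag sub by auto
      fix e f assume ef: "e \<in> insert {i, i + 2} T" "f \<in> insert {i, i + 2} T"
      have "\<not> interleaved {i, i + 2} {i, i + 2}" unfolding interleaved_iff cyc_def by auto
      then have "\<not> interleaved e f" using ef no_cross nc interleaved_commute by blast
      then show "\<not> crosses p e f" using cr ef diag sub by blast
    qed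
    then show ?thesis using T unfolding triangulation_def by blast
  qed
  moreover have "{i, i + 2} \<in> (\<lambda>l. {l, l + 2}) ` {..<n - 2}"
    using d(2,3) by (intro imageI) auto
  ultimately show "(\<lambda>l. {l, l + 2}) ` {..<n - 2} \<inter> T \<noteq> {}" by blast
qed

lemma finite_edges: "finite (edges n)"
  by (rule finite_subset[of _ "Pow {..<n}"]) (auto simp: edges_def)

lemma blocker_card_le:
  assumes "convex_ngon n p" "n \<ge> 4" "blocker n p B"
  shows "card B \<le> n - 2"
proof -
  have "card B \<le> card ((\<lambda>l. {l, l + 2}) ` {..<n - 2})"
    using assms linear_ears_blocking unfolding blocker_def by blast
  also have "\<dots> \<le> n - 2" using card_image_le[of "{..<n - 2}" "\<lambda>l. {l, l + 2}"] by simp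
  finally show ?thesis .
qed

lemma edges_subset_lessThan: "e \<in> edges n \<Longrightarrow> e \<subseteq> {..<n}"
  unfolding edges_def by auto

section \<open>The structure of blockers\<close>

definition ear_edge :: "nat \<Rightarrow> nat \<Rightarrow> nat set" where
  "ear_edge n v = {(v + n - 1) mod n, Suc v mod n}"

lemma ear_edge_eq:
  assumes "v < n"
  shows "ear_edge n v = {if v = 0 then n - 1 else v - 1, if Suc v = n then 0 else Suc v}"
proof -
  have "(v + n - 1) mod n = (if v = 0 then n - 1 else v - 1)"
  proof (cases v)
    case (Suc u)
    then have "(v + n - 1) mod n = (u + n) mod n" by simp
    then show ?thesis using Suc assms by simp
  qed (use assms in simp)
  moreover have "Suc v mod n = (if Suc v = n then 0 else Suc v)" using assms by simp
  ultimately show ?thesis unfolding ear_edge_def by simp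
qed

text \<open>With four vertices, opposite vertices share this diagonal; that case is treated
  separately in the theorem.\<close>

lemma inj_on_ear_edge: "n \<ge> 5 \<Longrightarrow> inj_on (ear_edge n) {..<n}"
  by (intro inj_onI) (auto simp: ear_edge_eq doubleton_eq_iff split: if_splits)

lemma ear_edge_shift:
  assumes "v < n"
  shows "(\<lambda>v. (v + r) mod n) ` ear_edge n v = ear_edge n ((v + r) mod n)"
proof -
  have "((v + n - 1) mod n + r) mod n = ((v + r) mod n + n - 1) mod n"
  proof -
    have "((v + n - 1) mod n + r) mod n = (v + r + (n - 1)) mod n"
      using assms by (simp add: mod_simps add_ac)
    also have "\<dots> = ((v + r) mod n + (n - 1)) mod n" by (simp add: mod_simps)
    finally show ?thesis using assms by simp
  qed
  moreover have "(Suc v mod n + r) mod n = Suc ((v + r) mod n) mod n"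
    by (simp add: mod_simps)
  ultimately show ?thesis unfolding ear_edge_def by simp
qed

lemma ear_good_rotate: "ear_good B (rotate m xs) \<longleftrightarrow> ear_good B xs"
  using ear_good_append_commute[of B "drop (m mod length xs) xs" "take (m mod length xs) xs"]
    ear_good_append_commute[of B "take (m mod length xs) xs" "drop (m mod length xs) xs"]
  by (auto simp: rotate_drop_take)

lemma upt_rotate:
  assumes "v < n"
  shows "rotate v [0..<n] = v # [Suc v..<n] @ [0..<v]"
  using assms upt_conv_Cons[of v n] by (simp add: rotate_drop_take take_upt del: upt_conv_Cons)

lemma no_other_edge:
  assumes "\<And>e. e \<in> B \<Longrightarrow> v \<in> e \<Longrightarrow> e = {v, t}" "z \<noteq> t"
  shows "{v, z} \<notin> B" "{z, v} \<notin> B"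
  using assms(1)[of "{v, z}"] assms(2) by (auto simp: doubleton_eq_iff insert_commute)

lemma non_ear_tip:
  assumes ng: "\<not> ear_good B [0..<n]" and B: "finite B" "card B \<le> n - 2" and n: "n \<ge> 4"
    and v: "v < n" "ear_edge n v \<notin> B"
  shows "\<exists>t<n. t \<noteq> v \<and> {v, t} \<in> B \<and> (\<forall>e\<in>B. v \<in> e \<longrightarrow> e = {v, t}) \<and> ear_edge n t \<in> B"
proof -
  define rest where "rest v = [Suc v..<n] @ [0..<v]" for v
  have ngv: "\<not> ear_good B (v # rest v)" if "v < n" for v
    using ng ear_good_rotate upt_rotate[OF that] rest_def by metis
  have rest: "set (rest v) = {..<n} - {v}" "distinct (v # rest v)" "Suc (length (rest v)) = n"
    if "v < n" for v
    using that unfolding rest_def by auto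
  have ends: "{last (rest v), hd (rest v)} = ear_edge n v" if "v < n" for v
    using that n unfolding rest_def
    by (auto simp: ear_edge_eq last_append hd_append split: if_splits)
  have "card B + 1 \<le> length (rest v)" using rest(3)[OF v(1)] B(2) n by linarith
  moreover have "{last (rest v), hd (rest v)} \<notin> B" using ends[OF v(1)] v(2) by simp
  ultimately obtain t where
    t: "t \<in> set (rest v)" "{v, t} \<in> B" "\<And>e. e \<in> B \<Longrightarrow> v \<in> e \<Longrightarrow> e = {v, t}"
    using unique_edge[OF ngv[OF v(1)] rest(2)[OF v(1)] B(1)] by metis
  have tn: "t < n" "t \<noteq> v" using t(1) rest(1)[OF v(1)] by auto
  \<comment> \<open>The flipped fan: once \<open>t\<close> is cut off, \<open>v\<close> has no edge
    of \<open>B\<close> to the remaining vertices, so the fan at \<open>v\<close> triangulates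
    them.\<close>
  have "ear_edge n t \<in> B"
  proof (rule ccontr)
    assume "ear_edge n t \<notin> B"
    then have "\<not> ear_good B (rest t)" using ear_good_cut ngv ends tn(1) by metis
    moreover have "v \<in> set (rest t)" using rest(1)[OF tn(1)] tn(2) v(1) by auto
    then obtain xs ys where xy: "rest t = xs @ v # ys" by (meson split_list)
    have "t \<notin> set (ys @ xs)" using rest(2)[OF tn(1)] xy by auto
    then have "\<forall>z\<in>set (ys @ xs). {v, z} \<notin> B" using no_other_edge(1)[OF t(3)] by metis
    then have "ear_good B ((v # ys) @ xs)" using ear_good_fan[of "ys @ xs" v B] by simp
    then have "ear_good B (rest t)" using ear_good_append_commute[of B "v # ys" xs] xy by simp
    ultimately show False by blast
  qed
  then show ?thesis using t tn by blast
qed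

text \<open>The triangle used is \<open>u\<close>, \<open>v\<close>, \<open>Suc a\<close>; the
  hypothesis \<open>a + 2 \<le> b\<close> puts \<open>Suc a\<close> strictly between
  \<open>a\<close> and \<open>b\<close>.\<close>

lemma crossing_edges_ear_good:
  assumes abuv: "a + 2 \<le> b" "b < u" "u < v" "v < n"
    and u: "\<And>e. e \<in> B \<Longrightarrow> u \<in> e \<Longrightarrow> e = {u, a}"
    and v: "\<And>e. e \<in> B \<Longrightarrow> v \<in> e \<Longrightarrow> e = {v, b}"
  shows "ear_good B [0..<n]"
proof -
  \<comment> \<open>The arcs beyond the sides of the triangle. \<open>A\<close>, which contains
    \<open>b\<close>, and \<open>D\<close> are fanned from \<open>u\<close>; \<open>E\<close>, which
    contains \<open>a\<close>, is fanned from \<open>v\<close>.\<close>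
  define A D E where "A = [a + 2..<u]" and "D = [Suc u..<v]" and "E = [Suc v..<n] @ [0..<Suc a]"
  note nu = no_other_edge[OF u] and nv = no_other_edge[OF v]
  have "ear_good B (v # E @ Suc a # [u])"
    using abuv unfolding E_def by (intro ear_good_fan_left ballI nv ear_good.small) auto
  then have "ear_good B (u # v # E @ [Suc a])"
    using ear_good_append_commute[of B "v # E @ [Suc a]" "[u]"] by simp
  then have "ear_good B (u # D @ v # E @ [Suc a])"
    using abuv unfolding D_def by (intro ear_good_fan_left ballI nu) auto
  then have "ear_good B (Suc a # u # D @ v # E)"
    using ear_good_append_commute[of B "u # D @ v # E" "[Suc a]"] by simp
  then have "ear_good B (Suc a # A @ u # D @ v # E)"
    using abuv unfolding A_def by (intro ear_good_fan_right ballI nu) auto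
  moreover have "Suc a # A @ u # D @ v # E = rotate (Suc a) [0..<n]"
  proof -
    have "[Suc (Suc a)..<n] = [a + 2..<u] @ u # [Suc u..<v] @ v # [Suc v..<n]"
      using abuv upt_add_eq_append[of "a + 2" u "n - u"] upt_conv_Cons[of u n]
        upt_add_eq_append[of "Suc u" v "n - v"] upt_conv_Cons[of v n] by simp
    then show ?thesis using upt_rotate[of "Suc a" n] abuv unfolding A_def D_def E_def by simp
  qed
  ultimately show ?thesis using ear_good_rotate by metis
qed

text \<open>The vertices beyond \<open>y\<close> are fanned from \<open>0\<close>, whose edge can
  only end at \<open>a < y\<close>; those before \<open>y\<close> are fanned from \<open>y\<close>,
  whose edge can only end at \<open>b > y\<close>.\<close>

lemma separated_edges_ear_good:
  assumes y: "a < y" "y < n" "b > y" "a \<noteq> 0"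
    and 0: "\<And>e. e \<in> B \<Longrightarrow> 0 \<in> e \<Longrightarrow> e = {0, a}"
    and ye: "\<And>e. e \<in> B \<Longrightarrow> y \<in> e \<Longrightarrow> e = {y, b}"
  shows "ear_good B [0..<n]"
proof -
  have "ear_good B (0 # y # [Suc y..<n])"
    using y by (intro ear_good_fan ballI no_other_edge(1)[OF 0]) auto
  then have "ear_good B (0 # [Suc 0..<y] @ y # [Suc y..<n])"
    using y by (intro ear_good_fan_right ballI no_other_edge[OF 0] no_other_edge[OF ye]) auto
  moreover have "[0..<n] = 0 # [Suc 0..<y] @ y # [Suc y..<n]"
    using y upt_conv_Cons[of 0 n] upt_add_eq_append[of "Suc 0" y "n - y"] upt_conv_Cons[of y n]
    by simp
  ultimately show ?thesis by simp
qed

text \<open>Call \<open>v\<close> a tip if \<open>ear_edge n v \<in> B\<close>. With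
  \<open>0\<close> a non-tip and \<open>1\<close> a tip, the tips turn out to be \<open>1\<close> to
  \<open>m + 1\<close>. The edges at the non-tips \<open>0\<close> and \<open>m + 2\<close> are
  \<open>{0, 2}\<close> and \<open>{m, m + 2}\<close>, so the second family runs over
  \<open>m + 3\<close> to \<open>n - 1\<close>.\<close>

lemma standard_form:
  assumes n: "n \<ge> 5" and ng: "\<not> ear_good B [0..<n]" and B: "B \<subseteq> edges n" "card B \<le> n - 2"
    and ears: "ear_edge n 0 \<notin> B" "ear_edge n 1 \<in> B"
  shows "\<exists>(m::nat) (i::nat \<Rightarrow> nat).
           1 \<le> m \<and> m \<le> n - 3 \<and>
           (\<forall>j\<in>{1..n - 3 - m}. 1 \<le> i j \<and> i j \<le> m + 1) \<and>
           (\<forall>j\<in>{1..n - 3 - m}. \<forall>k\<in>{1..n - 3 - m}.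
              \<bar>int (i j) - int (i k)\<bar> \<ge> 2 \<longrightarrow>
              \<not> interleaved {m + j + 2, i j} {m + k + 2, i k}) \<and>
           B = {{l, l + 2} | l. l \<le> m} \<union> {{m + j + 2, i j} | j. j \<in> {1..n - 3 - m}}"
proof -
  have fin: "finite B" using B(1) finite_edges finite_subset by blast
  have ear_mid: "ear_edge n v = {v - 1, v + 1}" if "1 \<le> v" "v < n - 1" for v
    using that by (auto simp: ear_edge_eq)
  have "\<forall>v\<in>{v. v < n \<and> ear_edge n v \<notin> B}. \<exists>t. t < n \<and> {v, t} \<in> B \<and>
      (\<forall>e\<in>B. v \<in> e \<longrightarrow> e = {v, t}) \<and> ear_edge n t \<in> B"
  proof
    fix v assume "v \<in> {v. v < n \<and> ear_edge n v \<notin> B}"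
    then obtain t where "t < n" "{v, t} \<in> B" "\<forall>e\<in>B. v \<in> e \<longrightarrow> e = {v, t}" "ear_edge n t \<in> B"
      using non_ear_tip[OF ng fin B(2), of v] n by auto
    then show "\<exists>t. t < n \<and> {v, t} \<in> B \<and> (\<forall>e\<in>B. v \<in> e \<longrightarrow> e = {v, t}) \<and> ear_edge n t \<in> B"
      by blast
  qed
  from bchoice[OF this] obtain t where t: "t v < n \<and> {v, t v} \<in> B \<and>
      (\<forall>e\<in>B. v \<in> e \<longrightarrow> e = {v, t v}) \<and> ear_edge n (t v) \<in> B"
    if "v < n" "ear_edge n v \<notin> B" for v
    by auto
  have only: "e = {v, t v}" if "e \<in> B" "v \<in> e" "v < n" "ear_edge n v \<notin> B" for v e
    using t that by blast
  \<comment> \<open>The ear with tip \<open>1\<close> contains the non-tip \<open>0\<close>, so it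
    is the only edge there; its far end \<open>2\<close> is then a tip.\<close>
  have "{0, 2} \<in> B" using ears(2) ear_mid[of 1] n by (simp add: numeral_2_eq_2)
  then have "{0, 2} = {0, t 0}" using only[of "{0, 2}" 0] ears(1) n by auto
  then have t0: "t 0 = 2" by (auto simp: doubleton_eq_iff)
  then have ear2: "ear_edge n 2 \<in> B" using t[of 0] ears(1) n by auto
  \<comment> \<open>After a non-tip \<open>v\<close> no tip follows: its ear
    \<open>{v, v + 2}\<close> would be the only edge at \<open>v\<close>, and the chord
    \<open>(0, v)\<close> would separate it from \<open>{0, 2}\<close>.\<close>
  have upward: "ear_edge n (Suc v) \<notin> B" if v: "1 \<le> v" "Suc v < n" "ear_edge n v \<notin> B" for v
  proof
    assume s: "ear_edge n (Suc v) \<in> B"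
    have v2: "v \<noteq> 2" using v(3) ear2 by auto
    have v1: "v \<noteq> 1" using v(3) ears(2) by auto
    \<comment> \<open>The ear of the last vertex wraps around to \<open>{v, 0}\<close>, but the only
      edge at \<open>0\<close> ends at \<open>2\<close>.\<close>
    have "Suc (Suc v) \<noteq> n"
    proof
      assume last: "Suc (Suc v) = n"
      then have "ear_edge n (Suc v) = {v, 0}" by (simp add: ear_edge_eq)
      then have "{v, 0} = {0, t 0}" using s only[of "{v, 0}" 0] ears(1) n by simp
      then show False using t0 v2 by (auto simp: doubleton_eq_iff)
    qed
    then have "ear_edge n (Suc v) = {v, v + 2}" using v ear_mid[of "Suc v"] by simp
    then have "{v, v + 2} = {v, t v}" using s only[of "{v, v + 2}" v] v by simp
    then have tv: "t v = v + 2" by (auto simp: doubleton_eq_iff)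
    have "ear_good B [0..<n]"
    proof (rule separated_edges_ear_good[of 2 v n "v + 2"])
      show "e = {0, 2}" if "e \<in> B" "0 \<in> e" for e
        using only[OF that] ears(1) n t0 by simp
      show "e = {v, v + 2}" if "e \<in> B" "v \<in> e" for e
        using only[OF that] v tv by simp
    qed (use v v1 v2 in auto)
    then show False using ng by simp
  qed
  have ex_tip: "\<exists>q. 1 \<le> q \<and> q < n \<and> ear_edge n q \<notin> B"
  proof (rule ccontr)
    assume "\<not> ?thesis"
    then have "ear_edge n ` {1..<n} \<subseteq> B" by auto
    then have "card (ear_edge n ` {1..<n}) \<le> card B" using fin by (rule card_mono[rotated])
    moreover have "inj_on (ear_edge n) {1..<n}"
      by (rule inj_on_subset[OF inj_on_ear_edge[OF n]]) auto
    then have "card (ear_edge n ` {1..<n}) = n - 1" by (simp add: card_image)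
    ultimately show False using B(2) n by linarith
  qed
  define q where "q = (LEAST q. 1 \<le> q \<and> q < n \<and> ear_edge n q \<notin> B)"
  have q: "1 \<le> q" "q < n" "ear_edge n q \<notin> B"
    using LeastI_ex[OF ex_tip] unfolding q_def by auto
  have below: "ear_edge n v \<in> B" if "1 \<le> v" "v < q" for v
    using not_less_Least[of v "\<lambda>q. 1 \<le> q \<and> q < n \<and> ear_edge n q \<notin> B"] that q(2)
    unfolding q_def[symmetric] by auto
  have above: "ear_edge n v \<notin> B" if "q \<le> v" "v < n" for v
    using that
  proof (induction v rule: dec_induct)
    case base
    then show ?case using q by simp
  next
    case (step v)
    then show ?case using upward[of v] q by simp
  qed
  have q3: "q \<ge> 3"
  proof (rule ccontr)
    assume "\<not> q \<ge> 3"
    then have "q = 1 \<or> q = 2" using q(1) by auto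
    then show False using q(3) ears(2) ear2 by auto
  qed
  \<comment> \<open>The tips \<open>1\<close> to \<open>q - 1\<close> belong to the ears
    \<open>{l, l + 2}\<close> with \<open>l \<le> q - 2\<close>.\<close>
  define m where "m = q - 2"
  define i where "i j = t (m + j + 2)" for j
  have m: "1 \<le> m" "m \<le> n - 3" "q = m + 2" using q q3 unfolding m_def by auto
  have tip: "m + j + 2 < n" "ear_edge n (m + j + 2) \<notin> B" if "j \<in> {1..n - 3 - m}" for j
  proof -
    have "1 \<le> j" "j \<le> n - 3 - m" using that by auto
    then show "m + j + 2 < n" by linarith
    then show "ear_edge n (m + j + 2) \<notin> B" using above m by simp
  qed
  \<comment> \<open>The edge at a non-tip leads to a tip, and the tips are \<open>1\<close> to
    \<open>m + 1\<close>.\<close>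
  have i: "1 \<le> i j" "i j \<le> m + 1" if "j \<in> {1..n - 3 - m}" for j
  proof -
    have it: "i j < n" "ear_edge n (i j) \<in> B" using t[OF tip[OF that]] unfolding i_def by auto
    then show "1 \<le> i j" using ears(1) by (cases "i j") auto
    show "i j \<le> m + 1" using it above[of "i j"] m by fastforce
  qed
  have edge_at: "e = {m + j + 2, i j}" if "j \<in> {1..n - 3 - m}" "e \<in> B" "m + j + 2 \<in> e" for j e
    using only[OF that(2,3) tip[OF that(1)]] unfolding i_def .
  let ?R = "{{l, l + 2} | l. l \<le> m} \<union> {{m + j + 2, i j} | j. j \<in> {1..n - 3 - m}}"
  have "{l, l + 2} \<in> B" if "l \<le> m" for l
    using that ear_mid[of "Suc l"] below[of "Suc l"] m q by simp
  moreover have "{m + j + 2, i j} \<in> B" if "j \<in> {1..n - 3 - m}" for j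
    using t[OF tip[OF that]] unfolding i_def by simp
  ultimately have RB: "?R \<subseteq> B" by auto
  then have fin_R: "finite ?R" using fin finite_subset by blast
  \<comment> \<open>The edges in \<open>?R\<close> are told apart by their maxima, so there are at least \<open>n - 2\<close> of them.\<close>
  have "{2..<n} \<subseteq> Max ` ?R"
  proof
    fix x assume x: "x \<in> {2..<n}"
    show "x \<in> Max ` ?R"
    proof (cases "x \<le> m + 2")
      case True
      then have "x = Max {x - 2, x - 2 + 2}" "{x - 2, x - 2 + 2} \<in> ?R" using x by auto
      then show ?thesis by blast
    next
      case False
      define j where "j = x - (m + 2)"
      have j: "j \<in> {1..n - 3 - m}" "x = m + j + 2" using False x m unfolding j_def by auto
      then have "x = Max {m + j + 2, i j}" using i[OF j(1)] by simp
      moreover have "{m + j + 2, i j} \<in> ?R" using j by blast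
      ultimately show ?thesis by blast
    qed
  qed
  then have "card {2..<n} \<le> card (Max ` ?R)" by (intro card_mono finite_imageI fin_R)
  also have "\<dots> \<le> card ?R" by (rule card_image_le[OF fin_R])
  finally have "card B \<le> card ?R" using B(2) by simp
  then have eq: "B = ?R" using card_seteq[OF fin RB] by simp
  have nc: "\<not> interleaved {m + j + 2, i j} {m + k + 2, i k}"
    if j: "j \<in> {1..n - 3 - m}" and k: "k \<in> {1..n - 3 - m}" and less: "i j + 2 \<le> i k" for j k
  proof
    assume "interleaved {m + j + 2, i j} {m + k + 2, i k}"
    then have "interleaved {i j, m + j + 2} {i k, m + k + 2}" by (simp add: insert_commute)
    \<comment> \<open>As \<open>i j < i k\<close>, crossing forces the upper ends into the same
      order.\<close>
    then have "m + j + 2 < m + k + 2"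
      using interleaved_iff_less[of "i j" "m + j + 2" "i k" "m + k + 2"] i[OF j] i[OF k] less by auto
    then have "ear_good B [0..<n]"
      using crossing_edges_ear_good[of "i j" "i k" "m + j + 2" "m + k + 2" n B]
        less i[OF k] tip[OF k] edge_at[OF j] edge_at[OF k] by simp
    then show False using ng by simp
  qed
  show ?thesis
  proof (intro exI[of _ m] exI[of _ i] conjI ballI impI)
    fix j k assume jk: "j \<in> {1..n - 3 - m}" "k \<in> {1..n - 3 - m}" "2 \<le> \<bar>int (i j) - int (i k)\<bar>"
    then consider "i j + 2 \<le> i k" | "i k + 2 \<le> i j" by linarith
    then show "\<not> interleaved {m + j + 2, i j} {m + k + 2, i k}"
      using nc jk(1,2) interleaved_commute by cases blast+
  qed (use m i eq in auto)
qed

section \<open>Rotating into standard position\<close>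

text \<open>Provides the vertex to be moved to \<open>0\<close>. Counting yields a non-tip, and its
  edge in \<open>B\<close> leads to a tip; walking upwards from the one to the other passes from a
  non-tip to a tip.\<close>

lemma boundary_tip:
  assumes n: "n \<ge> 5" and ng: "\<not> ear_good B [0..<n]" and fin: "finite B" and card: "card B \<le> n - 2"
  shows "\<exists>v<n. ear_edge n v \<notin> B \<and> ear_edge n (Suc v mod n) \<in> B"
proof (rule ccontr)
  assume "\<not> ?thesis"
  then have step: "ear_edge n (Suc v mod n) \<notin> B" if "v < n" "ear_edge n v \<notin> B" for v
    using that by blast
  have "\<exists>v<n. ear_edge n v \<notin> B"
  proof (rule ccontr)
    assume "\<not> ?thesis"
    then have "ear_edge n ` {..<n} \<subseteq> B" by auto
    then have "card (ear_edge n ` {..<n}) \<le> card B" using fin by (rule card_mono[rotated])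
    then show False using card n inj_on_ear_edge[OF n] by (simp add: card_image)
  qed
  then obtain v where v: "v < n" "ear_edge n v \<notin> B" by auto
  then obtain t where t: "t < n" "ear_edge n t \<in> B"
    using non_ear_tip[OF ng fin card] n by auto
  have all: "ear_edge n ((v + k) mod n) \<notin> B" for k
  proof (induction k)
    case 0
    then show ?case using v by simp
  next
    case (Suc k)
    then show ?case using step[of "(v + k) mod n"] n by (simp add: mod_Suc_eq)
  qed
  have "(v + (n - v + t)) mod n = t" using v(1) t(1) by simp
  then show False using all[of "n - v + t"] t(2) by simp
qed

lemma rotate_edges_blocking:
  assumes ng: "\<not> ear_good B [0..<n]" and B: "B \<subseteq> edges n"
  shows "\<not> ear_good (rotate_edges n r B) [0..<n]" "rotate_edges n r B \<subseteq> edges n"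
    and "\<And>e. e \<subseteq> {..<n} \<Longrightarrow> (\<lambda>v. (v + r) mod n) ` e \<in> rotate_edges n r B \<longleftrightarrow> e \<in> B"
proof -
  let ?f = "\<lambda>v. (v + r) mod n"
  have inj: "inj_on ?f {..<n}"
  proof (rule inj_onI)
    fix x y assume xy: "x \<in> {..<n}" "y \<in> {..<n}" "(x + r) mod n = (y + r) mod n"
    then have "[x + r = y + r] (mod n)" by (simp add: cong_def)
    then have "[x = y] (mod n)" by (simp add: cong_add_rcancel_nat)
    then show "x = y" using xy by (simp add: cong_def)
  qed
  have lt: "?f v < n" if "v < n" for v using that by simp
  have sub: "e \<subseteq> {..<n}" if "e \<in> B" for e using that B edges_subset_lessThan by blast
  show "?f ` e \<in> rotate_edges n r B \<longleftrightarrow> e \<in> B" if e: "e \<subseteq> {..<n}" for e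
  proof -
    have "e \<in> B" if "?f ` e = ?f ` e'" "e' \<in> B" for e'
      using inj_on_image_eq_iff[OF inj e sub[OF that(2)]] that by simp
    then show ?thesis unfolding rotate_edges_def by auto
  qed
  show "rotate_edges n r B \<subseteq> edges n"
  proof
    fix e assume "e \<in> rotate_edges n r B"
    then obtain x y where xy: "x < n" "y < n" "x \<noteq> y" "e = {?f x, ?f y}"
      using B unfolding rotate_edges_def edges_def by auto
    moreover have "?f x \<noteq> ?f y" using xy inj_on_eq_iff[OF inj, of x y] by simp
    moreover have "?f x < n" "?f y < n" using lt xy by blast+
    ultimately show "e \<in> edges n" unfolding edges_eq_pairs by (simp add: doubleton_in_pairs_iff)
  qed
  \<comment> \<open>Shifting the labels only rotates the list, which does not affect
    \<open>ear_good\<close>.\<close>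
  have rot: "rotate r [0..<n] = map ?f [0..<n]"
    by (rule nth_equalityI) (simp_all add: nth_rotate add.commute)
  have "B \<subseteq> Pow {..<n}" using sub by auto
  note map = ear_good_map[OF inj this _ rot]
  show "\<not> ear_good (rotate_edges n r B) [0..<n]"
  proof
    assume "ear_good (rotate_edges n r B) [0..<n]"
    then have "ear_good (image ?f ` B) (rotate r [0..<n])"
      unfolding rotate_edges_def ear_good_rotate .
    then have "ear_good B [0..<n]" by (rule map) auto
    then show False using ng by blast
  qed
qed

theorem theorem1p1:
  fixes n :: nat and p :: "nat \<Rightarrow> real ^ 2" and B :: "nat set set"
  assumes "n \<ge> 4"
    and "convex_ngon n p"
    and "blocker n p B"
  shows "\<exists>(r::nat) (m::nat) (i::nat \<Rightarrow> nat).
           1 \<le> m \<and> m \<le> n - 3 \<and>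
           (\<forall>j\<in>{1..n - 3 - m}. 1 \<le> i j \<and> i j \<le> m + 1) \<and>
           (\<forall>j\<in>{1..n - 3 - m}. \<forall>k\<in>{1..n - 3 - m}.
              \<bar>int (i j) - int (i k)\<bar> \<ge> 2 \<longrightarrow>
              \<not> crosses p {m + j + 2, i j} {m + k + 2, i k}) \<and>
           rotate_edges n r B =
             {{l, l + 2} | l. l \<le> m} \<union> {{m + j + 2, i j} | j. j \<in> {1..n - 3 - m}}"
proof -
  have ng: "\<not> ear_good B [0..<n]" and B: "B \<subseteq> edges n"
    using blocking_imp_not_ear_good assms(2,3) unfolding blocker_def blocking_set_def by auto
  have card: "card B \<le> n - 2" using blocker_card_le assms by blast
  have fin: "finite B" using B finite_edges finite_subset by blast
  show ?thesis
  proof (cases "n = 4")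
    case True
    have list: "[0..<n] = [0, 1, 2, 3]" unfolding True by (simp add: upt_rec)
    \<comment> \<open>In a quadrilateral each diagonal alone is a triangulation, so \<open>B\<close>
      contains both.\<close>
    have "{0, 2} \<in> B"
      using ng ear_good.ear[of 0 2 B "[3]" 1] ear_good.small[of "[0, 2, 3]" B]
      unfolding list by fastforce
    moreover have "{1, 3} \<in> B"
      using ng ear_good_cut[of B "[1, 2, 3]" 0] ear_good.small[of "[1, 2, 3]" B]
      unfolding list by (fastforce simp: insert_commute)
    ultimately have sub: "{{0, 2}, {1, 3}} \<subseteq> B" by simp
    have "card {{0, 2}, {1, 3 :: nat}} = 2" by (simp add: doubleton_eq_iff)
    then have eq: "B = {{0, 2}, {1, 3}}" using card_seteq[OF fin sub] card True by simp
    have "rotate_edges n 0 B = B"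
      unfolding rotate_edges_def eq True by simp
    moreover have "{{l, l + 2} | l. l \<le> (1::nat)} = {{0, 2}, {1, 3}}"
      by (auto simp: le_Suc_eq)
    \<comment> \<open>With \<open>m = 1\<close> the second family is empty, so \<open>i\<close> is
      arbitrary.\<close>
    ultimately show ?thesis
      using eq True
      by - (rule exI[of _ 0], rule exI[of _ 1], rule exI[of _ "\<lambda>_. 0"], auto)
  next
    case False
    then have n: "n \<ge> 5" using assms(1) by simp
    obtain v where v: "v < n" "ear_edge n v \<notin> B" "ear_edge n (Suc v mod n) \<in> B"
      using boundary_tip[OF n ng fin card] by blast
    define r where "r = n - v"
    let ?C = "rotate_edges n r B"
    note C = rotate_edges_blocking[OF ng B, where r = r]
    have sub: "ear_edge n w \<subseteq> {..<n}" for w unfolding ear_edge_def using n by auto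
    have v0: "(v + r) mod n = 0" using v(1) unfolding r_def by simp
    have "(Suc v mod n + r) mod n = Suc ((v + r) mod n) mod n" by (simp add: mod_simps)
    then have "(Suc v mod n + r) mod n = 1" using v0 n by simp
    with v0 have "ear_edge n 0 \<notin> ?C" "ear_edge n 1 \<in> ?C"
      using C(3)[OF sub[of v]] C(3)[OF sub[of "Suc v mod n"]] v
        ear_edge_shift[of v n r] ear_edge_shift[of "Suc v mod n" n r] by simp_all
    note ears = this
    have card_C: "card ?C \<le> n - 2"
      using card card_image_le[OF fin] le_trans unfolding rotate_edges_def by blast
    obtain m i where mi: "1 \<le> m" "m \<le> n - 3"
      "\<forall>j\<in>{1..n - 3 - m}. 1 \<le> i j \<and> i j \<le> m + 1"
      "\<forall>j\<in>{1..n - 3 - m}. \<forall>k\<in>{1..n - 3 - m}. \<bar>int (i j) - int (i k)\<bar> \<ge> 2 \<longrightarrow>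
              \<not> interleaved {m + j + 2, i j} {m + k + 2, i k}"
      "?C = {{l, l + 2} | l. l \<le> m} \<union> {{m + j + 2, i j} | j. j \<in> {1..n - 3 - m}}"
      using standard_form[OF n C(1,2) card_C ears] by (elim exE conjE) (rule that)
    show ?thesis
    proof (rule exI[of _ r], rule exI[of _ m], rule exI[of _ i], intro conjI ballI impI)
      fix j k
      assume jk: "j \<in> {1..n - 3 - m}" "k \<in> {1..n - 3 - m}" "\<bar>int (i j) - int (i k)\<bar> \<ge> 2"
      \<comment> \<open>Membership in the rotated set shows that both pairs are edges, so crossing
        of the rotated labels is again interleaving.\<close>
      then have "{m + j + 2, i j} \<in> ?C" "{m + k + 2, i k} \<in> ?C"
        unfolding mi(5) by blast+
      then have "{m + j + 2, i j} \<in> edges n" "{m + k + 2, i k} \<in> edges n"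
        using C(2) by blast+
      then show "\<not> crosses p {m + j + 2, i j} {m + k + 2, i k}"
        using crosses_iff_interleaved[OF assms(2)] mi(4) jk by simp
    next
      show "?C = {{l, l + 2} | l. l \<le> m} \<union> {{m + j + 2, i j} | j. j \<in> {1..n - 3 - m}}"
        by (rule mi(5))
    qed (use mi(1,2,3) in simp_all)
  qed
qed

end
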